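(* Let $p=p(x)$, $x\in\mathbb R$, be the density of a probability distribution with cumulative distribution function $F(x)=\int_{-\infty}^x p(y)\,dy$. Assume: (i) $p$ is continuous on $\mathbb R$ and $\int_{\mathbb R} p(x)\,|\log p(x)|\,dx<\infty$; (ii) there exist $x_0>0$ and $K>0$ such that for any $D>x_0$ and all $x,y$ with $|x|,|y|\in(x_0,D)$ it holds that $p(x)\le K\,p(y)$ if $|x-y|\le 1/D$. Let $\pi_N=\{x_k^N,\ k=0,\dots,k_N\}$ be a sequence of uniform partitions of $\mathbb R$ such that $x_0^N\to-\infty$, $x_{k_N}^N\to\infty$ and $|\pi_N|=\max_{1\le k\le k_N}\Delta x_k^N\to0$ as $N\to\infty$, where $\Delta x_k^N=x_k^N-x_{k-1}^N$. Put $\Delta F_k^N=F(x_k^N)-F(x_{k-1}^N)$. Then $$\mathcal H_{SH}^{(2)}=\lim_{N\to\infty}\sum_{k=1}^{k_N}\Delta F_k^N\left(\log\left(\frac{\Delta F_k^N}{\Delta x_k^N}\right)\right)_+,$$ $$\mathcal H_{SH}^{(3)}=\lim_{N\to\infty}\sum_{k=1}^{k_N}\Delta F_k^N\left(\log\left(\frac{\Delta F_k^N}{\Delta x_k^N}\right)+1\right),$$ where we put $\log\left(\Delta F_k^N/\Delta x_k^N\right)=0$ if $\Delta F_k^N=0$.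
   Context: Here $a_+=\max(a,0)$, and $\mathcal H_{SH}^{(2)}=\int_{\mathbb R}p(x)\,(-\log p(x))_+\,dx$ and $\mathcal H_{SH}^{(3)}=\int_{\mathbb R}p(x)\log\bigl((p(x))^{-1}+1\bigr)\,dx$ are alternative versions of the differential Shannon entropy $-\int_{\mathbb R}p(x)\log p(x)\,dx$. Integrals are taken over the support of $p$. A partition is uniform if all its increments $\Delta x_k^N$, $k=1,\dots,k_N$, are equal.
   Formalization: Summands corrected to ΔF(−log(ΔF/Δx))_+ and ΔF·log((ΔF/Δx)^{-1}+1), as the printed limits fail for the Gaussian; added hypothesis: |π_N|·max(|x_0^N|,|x_{k_N}^N|) is bounded in N, without which even the corrected limits fail for some p. *)

theory Defs
  imports "HOL-Probability.Probability"
begin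

(* Nonnegativity is stated separately because ennreal truncates negative values to 0. *)
definition prob_density :: "(real \<Rightarrow> real) \<Rightarrow> bool" where
  "prob_density p \<longleftrightarrow>
     p \<in> borel_measurable borel \<and> (\<forall>x. 0 \<le> p x) \<and>
     prob_space (density lborel (\<lambda>x. ennreal (p x)))"

definition distr_fun :: "(real \<Rightarrow> real) \<Rightarrow> real \<Rightarrow> real" where
  "distr_fun p x = (LBINT y:{..x}. p y)"

definition supp :: "(real \<Rightarrow> real) \<Rightarrow> real set" where
  "supp p = {x. p x \<noteq> 0}"

(* Quasi-homogeneity of the tails at the scale 1/D on the range x0 < |.| < D. *)
definition tail_regular :: "(real \<Rightarrow> real) \<Rightarrow> bool" where
  "tail_regular p \<longleftrightarrow>
     (\<exists>x0>0. \<exists>K>0. \<forall>D>x0. \<forall>x y.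
        \<bar>x\<bar> \<in> {x0<..<D} \<and> \<bar>y\<bar> \<in> {x0<..<D} \<and> \<bar>x - y\<bar> \<le> 1 / D \<longrightarrow> p x \<le> K * p y)"

definition shannon2 :: "(real \<Rightarrow> real) \<Rightarrow> real" where
  "shannon2 p = (LBINT x:supp p. p x * max (- ln (p x)) 0)"

definition shannon3 :: "(real \<Rightarrow> real) \<Rightarrow> real" where
  "shannon3 p = (LBINT x:supp p. p x * ln (inverse (p x) + 1))"

(* Increments are indexed from 1; a partition with n cells has the points f 0 < ... < f n. *)
definition incr :: "(nat \<Rightarrow> real) \<Rightarrow> nat \<Rightarrow> real" where
  "incr f k = f k - f (k - 1)"

definition uniform_partition :: "(nat \<Rightarrow> real) \<Rightarrow> nat \<Rightarrow> bool" where
  "uniform_partition f n \<longleftrightarrow>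
     1 \<le> n \<and> (\<forall>k\<in>{1..n}. 0 < incr f k) \<and> (\<forall>j\<in>{1..n}. \<forall>k\<in>{1..n}. incr f j = incr f k)"

definition mesh :: "(nat \<Rightarrow> real) \<Rightarrow> nat \<Rightarrow> real" where
  "mesh f n = Max (incr f ` {1..n})"

definition radius :: "(nat \<Rightarrow> real) \<Rightarrow> nat \<Rightarrow> real" where
  "radius f n = max \<bar>f 0\<bar> \<bar>f n\<bar>"

definition distr_incr :: "(real \<Rightarrow> real) \<Rightarrow> (nat \<Rightarrow> real) \<Rightarrow> nat \<Rightarrow> real" where
  "distr_incr p f = incr (\<lambda>j. distr_fun p (f j))"

(* In both sums a cell of zero probability contributes 0. *)
definition shannon2_sum :: "(real \<Rightarrow> real) \<Rightarrow> (nat \<Rightarrow> real) \<Rightarrow> nat \<Rightarrow> real" where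
  "shannon2_sum p f n = (\<Sum>k=1..n. distr_incr p f k *
     (if distr_incr p f k = 0 then 0
      else max (- ln (distr_incr p f k / incr f k)) 0))"

definition shannon3_sum :: "(real \<Rightarrow> real) \<Rightarrow> (nat \<Rightarrow> real) \<Rightarrow> nat \<Rightarrow> real" where
  "shannon3_sum p f n = (\<Sum>k=1..n. distr_incr p f k *
     (if distr_incr p f k = 0 then 0
      else ln (inverse (distr_incr p f k / incr f k) + 1)))"

end

theory Submission
  imports Defs "HOL-Real_Asymp.Real_Asymp"
begin

text \<open>Both sums have the form $\sum_k \Delta x_k\, \phi(\Delta F_k / \Delta x_k)$, with
  $\phi(q) = q\,(-\log q)_+$ for the first and $\phi(q) = q \log(q^{-1} + 1)$ for the second,
  and both limits are $\int \phi(p(t))\,dt$. Such a sum is the integral of the step function that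
  equals $\phi(\Delta F_k / \Delta x_k)$ on the $k$-th cell and $0$ outside the partition, so the
  theorem is an instance of dominated convergence for these step functions.

  By the mean value theorem the quotient $\Delta F_k / \Delta x_k$ is a value $p(s)$ of the density
  at a point of the cell (\<open>cell_average_near\<close>). Hence the step function at $t$ is $\phi(p(s))$
  with $|s - t|$ at most the mesh, and it converges to $\phi(p(t))$ because $\phi \circ p$ is
  continuous; continuity of $\phi$ at $0$ is the limit $q \log q \to 0$.

  For a dominating function, $\phi \circ p$ is bounded on a fixed compact interval. In the tails
  the regularity condition compares $p(s)$ and $p(t)$ only at distance $1/D$, where $D$ has the size
  of the radius of the partition. Since mesh times radius is bounded, a cell is covered by a number
  $m$ of such steps that does not depend on the partition, so $p(s)$ and $p(t)$ agree up to the fixed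
  factor $L = \max(K, 1)^m$ (\<open>chain_comparison\<close>). As $|\phi(q)| \le q\,(|\log q| + c)$, this bounds
  $|\phi(p(s))|$ by $L\,p(t)\,(|\log p(t)| + \log L + c)$, which is integrable by assumption
  (\<open>entropy_term_comparison\<close>).\<close>

section \<open>Uniform partitions and step functions\<close>

lemma uniform_partition_incr_eq_mesh:
  assumes "uniform_partition f n" "k \<in> {1..n}"
  shows "incr f k = mesh f n"
proof -
  have "incr f ` {1..n} = {incr f k}"
    using assms unfolding uniform_partition_def by fast
  then show ?thesis by (simp add: mesh_def)
qed

lemma uniform_partition_mono:
  assumes "uniform_partition f n" "i \<le> j" "j \<le> n"
  shows "f i \<le> f j"
  using assms(2,3)
proof (induction j rule: dec_induct)
  case (step m)
  have "0 < incr f (Suc m)"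
    using assms(1) step unfolding uniform_partition_def by auto
  then show ?case using step by (simp add: incr_def)
qed simp

text \<open>The right end of the cell is the first point of the sequence that is not to the left of $t$.\<close>

lemma cell_containing_point:
  assumes "f (0::nat) < (t::real)" "t \<le> f n"
  obtains k where "k \<in> {1..n}" "f (k - 1) < t" "t \<le> f k"
proof -
  define k where "k = (LEAST k. t \<le> f k)"
  have k: "t \<le> f k" unfolding k_def by (rule LeastI[of _ n]) (rule assms)
  have "k \<noteq> 0" using k assms(1) by (metis not_less)
  moreover have "k \<le> n" unfolding k_def by (rule Least_le) (rule assms)
  moreover have "f (k - 1) < t"
    using not_less_Least[of "k - 1" "\<lambda>k. t \<le> f k"] \<open>k \<noteq> 0\<close> unfolding k_def[symmetric] by force
  ultimately show thesis using k by (intro that[of k]) auto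
qed

definition cell_step :: "(nat \<Rightarrow> real) \<Rightarrow> (nat \<Rightarrow> real) \<Rightarrow> nat \<Rightarrow> real \<Rightarrow> real" where
  "cell_step v f n t = (\<Sum>k=1..n. v k * indicator {f (k - 1)<..f k} t)"

lemma cell_step_on_cell:
  assumes "uniform_partition f n" "k \<in> {1..n}" "f (k - 1) < t" "t \<le> f k"
  shows "cell_step v f n t = v k"
proof -
  have "indicator {f (j - 1)<..f j} t = (if j = k then 1 else 0 :: real)" if j: "j \<in> {1..n}" for j
  proof (cases j k rule: linorder_cases)
    case less
    then have "f j \<le> f (k - 1)"
      using assms(2) by (intro uniform_partition_mono[OF assms(1)]) auto
    then show ?thesis using less assms(3) by auto
  next
    case greater
    then have "f k \<le> f (j - 1)"
      using j by (intro uniform_partition_mono[OF assms(1)]) auto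
    then show ?thesis using greater assms(4) by auto
  qed (use assms in auto)
  then have "cell_step v f n t = (\<Sum>j=1..n. if j = k then v j else 0)"
    unfolding cell_step_def by (intro sum.cong) auto
  then show ?thesis using assms(2) by simp
qed

lemma cell_step_outside:
  assumes "uniform_partition f n" "t \<notin> {f 0<..f n}"
  shows "cell_step v f n t = 0"
  unfolding cell_step_def
proof (intro sum.neutral ballI)
  fix k assume k: "k \<in> {1..n}"
  have "f 0 \<le> f (k - 1)" "f k \<le> f n"
    using k by (auto intro!: uniform_partition_mono[OF assms(1)])
  then show "v k * indicator {f (k - 1)<..f k} t = 0"
    using assms(2) by auto
qed

lemma integral_cell_step:
  assumes "uniform_partition f n"
  shows "(LBINT t. cell_step v f n t) = (\<Sum>k=1..n. incr f k * v k)"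
proof -
  have "(LBINT t. cell_step v f n t) = (\<Sum>k=1..n. LBINT t. v k * indicator {f (k - 1)<..f k} t)"
    unfolding cell_step_def
    by (intro Bochner_Integration.integral_sum integrable_mult_right integrable_real_indicator
        emeasure_bounded_finite
        bounded_subset[OF bounded_closed_interval
          greaterThanAtMost_subseteq_atLeastAtMost_iff[THEN iffD2]])
      auto
  also have "\<dots> = (\<Sum>k=1..n. incr f k * v k)"
  proof (intro sum.cong refl)
    fix k assume k: "k \<in> {1..n}"
    have "f (k - 1) \<le> f k"
      using k by (intro uniform_partition_mono[OF assms]) auto
    then show "(LBINT t. v k * indicator {f (k - 1)<..f k} t) = incr f k * v k"
      by (simp add: incr_def)
  qed
  finally show ?thesis .
qed

lemma cell_step_measurable: "cell_step v f n \<in> borel_measurable borel"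
  unfolding cell_step_def by measurable

section \<open>Cell averages of a continuous density\<close>

lemma prob_density_integrable:
  assumes "prob_density p"
  shows "integrable lborel p"
proof -
  interpret prob_space "density lborel (\<lambda>x. ennreal (p x))"
    using assms by (simp add: prob_density_def)
  have [measurable]: "p \<in> borel_measurable borel" and nn: "\<And>x. 0 \<le> p x"
    using assms by (auto simp: prob_density_def)
  have "(\<integral>\<^sup>+x. ennreal (p x) \<partial>lborel) = 1"
    using emeasure_space_1 by (simp add: emeasure_density)
  then show ?thesis
    using nn by (intro integrableI_nonneg) auto
qed

text \<open>The distribution function is an antiderivative of the continuous density, so the mean value
  theorem applies to it.\<close>

lemma distr_fun_mean_value:
  assumes "prob_density p" "continuous_on UNIV p" "a < b"
  obtains s where "s \<in> {a..b}" "distr_fun p b - distr_fun p a = p s * (b - a)"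
proof -
  have int: "set_integrable lborel A p" if "A \<in> sets borel" for A
    using prob_density_integrable[OF assms(1)] that
    unfolding set_integrable_def by (intro integrable_mult_indicator) auto
  have "distr_fun p b = (LBINT y:{..a} \<union> {a<..b}. p y)"
    unfolding distr_fun_def using assms(3) by (simp add: ivl_disj_un)
  also have "\<dots> = distr_fun p a + (LBINT y:{a<..b}. p y)"
    unfolding distr_fun_def by (intro set_integral_Un int) auto
  also have "(LBINT y:{a<..b}. p y) = integral {a<..b} p"
    by (intro set_borel_integral_eq_integral int) auto
  also have "integral {a<..b} p = integral {a..b} p"
    by (intro integral_spike_set) (auto intro: negligible_subset[of "{a}"])
  finally have F: "distr_fun p b - distr_fun p a = integral {a..b} p" by simp
  have "\<exists>s\<in>{a<..<b}. integral {a..b} p - integral {a..a} p = (\<lambda>h. h * p s) (b - a)"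
  proof (rule mvt_simple[OF assms(3)])
    fix u assume "a \<le> u" "u \<le> b"
    then have "((\<lambda>u. integral {a..u} p) has_real_derivative p u) (at u within {a..b})"
      by (intro integral_has_real_derivative continuous_on_subset[OF assms(2)]) auto
    then show "((\<lambda>u. integral {a..u} p) has_derivative (\<lambda>h. h * p u)) (at u within {a..b})"
      by (simp add: has_field_derivative_def mult.commute[of _ "p u"])
  qed
  then obtain s where "s \<in> {a<..<b}" "integral {a..b} p = (b - a) * p s" by auto
  then show thesis using F by (intro that[of s]) (auto simp: mult.commute)
qed

text \<open>Replacing an average over a cell by a single value of $p$ reduces convergence and domination
  of the step functions to pointwise comparisons of $p(s)$ with $p(t)$. The point $s$ stays in the
  range of the partition, where the tail condition can be used with the radius of the partition.\<close>

lemma cell_average_near: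
  assumes "prob_density p" "continuous_on UNIV p" "uniform_partition f n" "t \<in> {f 0<..f n}"
  obtains s where "s \<in> {f 0..f n}" "\<bar>s - t\<bar> \<le> mesh f n"
    "cell_step (\<lambda>k. \<phi> (distr_incr p f k / incr f k)) f n t = \<phi> (p s)"
proof -
  obtain k where k: "k \<in> {1..n}" "f (k - 1) < t" "t \<le> f k"
    using cell_containing_point[of f t n] assms(4) by auto
  have "f (k - 1) < f k" using k by simp
  from distr_fun_mean_value[OF assms(1,2) this] obtain s where
    s: "s \<in> {f (k - 1)..f k}" "distr_fun p (f k) - distr_fun p (f (k - 1)) = p s * (f k - f (k - 1))"
    by blast
  have "distr_incr p f k / incr f k = p s"
    using s(2) k by (simp add: distr_incr_def incr_def)
  moreover have "f 0 \<le> f (k - 1)" "f k \<le> f n"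
    using k by (auto intro!: uniform_partition_mono[OF assms(3)])
  moreover have "f k - f (k - 1) = mesh f n"
    using uniform_partition_incr_eq_mesh[OF assms(3) k(1)] by (simp add: incr_def)
  ultimately show thesis
    using s(1) k cell_step_on_cell[OF assms(3) k] by (intro that[of s]) auto
qed

section \<open>Comparison of values of the density in the tails\<close>

text \<open>Going from $u$ to $v$ in $m$ equal steps of length at most $1/D$ costs a factor $K$ per
  step. All intermediate points lie on the segment, which therefore has to avoid the core
  $[-x_0, x_0]$.\<close>

lemma chain_comparison:
  fixes u v :: real and p :: "real \<Rightarrow> real"
  assumes reg: "\<And>x y. \<bar>x\<bar> \<in> {x0<..<D} \<Longrightarrow> \<bar>y\<bar> \<in> {x0<..<D} \<Longrightarrow> \<bar>x - y\<bar> \<le> 1 / D \<Longrightarrow> p x \<le> K * p y"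
    and "0 < K"
    and "closed_segment u v \<subseteq> {z. \<bar>z\<bar> \<in> {x0<..<D}}" "\<bar>u - v\<bar> \<le> real m / D"
  shows "p u \<le> K ^ m * p v"
  using assms(3,4)
proof (induction m arbitrary: u)
  case (Suc m)
  \<comment> \<open>The first of the $m + 1$ equal steps leads from $u$ to $w$.\<close>
  define r where "r = real m / real (Suc m)"
  define w where "w = v + (u - v) * r"
  have "0 \<le> r" "r \<le> 1" and r: "1 - r = 1 / real (Suc m)"
    unfolding r_def by (auto simp: field_simps)
  then have w: "w \<in> closed_segment u v"
    unfolding in_segment w_def by (intro exI[of _ "1 - r"]) (auto simp: algebra_simps)
  have "u - w = (u - v) * (1 - r)"
    unfolding w_def by (simp add: algebra_simps)
  then have uw: "u - w = (u - v) / real (Suc m)" unfolding r by simp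
  have wv: "w - v = (u - v) / real (Suc m) * real m"
    unfolding w_def r_def by simp
  have le: "\<bar>u - v\<bar> / real (Suc m) \<le> 1 / D"
  proof -
    have "\<bar>u - v\<bar> / real (Suc m) \<le> (real (Suc m) / D) / real (Suc m)"
      by (intro divide_right_mono Suc.prems) auto
    then show ?thesis by simp
  qed
  have "p u \<le> K * p w"
  proof (rule reg)
    show "\<bar>u - w\<bar> \<le> 1 / D" using le unfolding uw by (simp add: abs_divide)
  qed (use Suc.prems(1) w in auto)
  also have "K * p w \<le> K * (K ^ m * p v)"
  proof (rule mult_left_mono)
    show "p w \<le> K ^ m * p v"
    proof (rule Suc.IH)
      show "closed_segment w v \<subseteq> {z. \<bar>z\<bar> \<in> {x0<..<D}}"
        using w Suc.prems(1) subset_closed_segment[of w v u v] by auto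
      have "\<bar>w - v\<bar> = \<bar>u - v\<bar> / real (Suc m) * real m"
        unfolding wv by (simp add: abs_mult abs_divide)
      also have "\<dots> \<le> 1 / D * real m" by (intro mult_right_mono le) auto
      finally show "\<bar>w - v\<bar> \<le> real m / D" by simp
    qed
  qed (use \<open>0 < K\<close> in simp)
  finally show ?case by (simp add: mult.assoc)
qed simp

text \<open>Values comparable up to the factor $L$ have logarithms that differ by at most $\log L$; if one
  of them vanishes, so does the other.\<close>

lemma entropy_term_comparison:
  fixes a b c L :: real
  assumes "0 \<le> a" "0 \<le> b" "a \<le> L * b" "b \<le> L * a" "1 \<le> L" "0 \<le> c"
  shows "a * (\<bar>ln a\<bar> + c) \<le> L * (b * \<bar>ln b\<bar>) + L * (ln L + c) * b"
proof (cases "b = 0")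
  case False
  then have "0 < b" using assms by simp
  moreover have "0 < a" using assms \<open>0 < b\<close> by (cases "a = 0") auto
  moreover have "ln a \<le> ln (L * b)" "ln b \<le> ln (L * a)"
    using assms \<open>0 < a\<close> \<open>0 < b\<close> by auto
  ultimately have "\<bar>ln a\<bar> \<le> \<bar>ln b\<bar> + ln L"
    using assms by (auto simp: ln_mult)
  then have "a * (\<bar>ln a\<bar> + c) \<le> (L * b) * (\<bar>ln b\<bar> + ln L + c)"
    using assms by (intro mult_mono) auto
  then show ?thesis by (simp add: algebra_simps)
qed (use assms in auto)

section \<open>Convergence of the sums\<close>

text \<open>The dominated convergence argument, for every continuous $\phi$ whose growth is controlled by
  $q\,|\log q|$ and $q$. The bound forces $\phi(0) = 0$, so the part of the line not covered by the
  partition and the zeros of $p$ contribute nothing.\<close>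

lemma entropy_sum_tendsto:
  fixes p :: "real \<Rightarrow> real" and x :: "nat \<Rightarrow> nat \<Rightarrow> real" and n :: "nat \<Rightarrow> nat"
    and \<phi> :: "real \<Rightarrow> real"
  assumes dens: "prob_density p"
    and cont: "continuous_on UNIV p"
    and ent: "set_integrable lborel (supp p) (\<lambda>t. p t * \<bar>ln (p t)\<bar>)"
    and reg: "tail_regular p"
    and part: "\<And>N. uniform_partition (x N) (n N)"
    and lower: "filterlim (\<lambda>N. x N 0) at_bot sequentially"
    and upper: "filterlim (\<lambda>N. x N (n N)) at_top sequentially"
    and mesh0: "(\<lambda>N. mesh (x N) (n N)) \<longlonglongrightarrow> 0"
    and scale: "Bseq (\<lambda>N. mesh (x N) (n N) * radius (x N) (n N))"
    and \<phi>_cont: "continuous_on {0..} \<phi>"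
    and \<phi>_bound: "\<And>q. 0 \<le> q \<Longrightarrow> \<bar>\<phi> q\<bar> \<le> q * (\<bar>ln q\<bar> + c)"
    and "0 \<le> c"
  shows "(\<lambda>N. \<Sum>k=1..n N. incr (x N) k * \<phi> (distr_incr p (x N) k / incr (x N) k))
           \<longlonglongrightarrow> (LBINT t. \<phi> (p t))"
proof -
  define S where "S N = cell_step (\<lambda>k. \<phi> (distr_incr p (x N) k / incr (x N) k)) (x N) (n N)" for N
  define \<delta> where "\<delta> N = mesh (x N) (n N)" for N
  have nn: "0 \<le> p t" for t using dens by (simp add: prob_density_def)
  have \<delta>0: "\<delta> \<longlonglongrightarrow> 0" using mesh0 by (simp add: \<delta>_def[abs_def])
  have near: "\<exists>s. s \<in> {x N 0..x N (n N)} \<and> \<bar>s - t\<bar> \<le> \<delta> N \<and> S N t = \<phi> (p s)"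
    if "t \<in> {x N 0<..x N (n N)}" for N t
    using cell_average_near[OF dens cont part that] unfolding S_def \<delta>_def by metis
  have \<phi>p: "continuous_on UNIV (\<lambda>t. \<phi> (p t))"
    by (rule continuous_on_compose2[OF \<phi>_cont cont]) (use nn in auto)
  obtain x0 K where "0 < x0" "0 < K" and regK:
    "\<And>D u v. D > x0 \<Longrightarrow> \<bar>u\<bar> \<in> {x0<..<D} \<Longrightarrow> \<bar>v\<bar> \<in> {x0<..<D} \<Longrightarrow> \<bar>u - v\<bar> \<le> 1 / D \<Longrightarrow> p u \<le> K * p v"
    using reg unfolding tail_regular_def by blast
  \<comment> \<open>A constant at least $1$ makes $\log L$ below nonnegative.\<close>
  define K1 where "K1 = max K 1"
  have regK1: "p u \<le> K1 * p v"
    if "D > x0" "\<bar>u\<bar> \<in> {x0<..<D}" "\<bar>v\<bar> \<in> {x0<..<D}" "\<bar>u - v\<bar> \<le> 1 / D" for D u v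
    using regK[OF that] mult_right_mono[OF _ nn, of K K1 v] by (simp add: K1_def)
  obtain B where B: "\<And>N. \<bar>\<delta> N * radius (x N) (n N)\<bar> \<le> B"
    using scale unfolding Bseq_def \<delta>_def by auto
  \<comment> \<open>With $D$ = radius + $x_0 + 1$ and mesh $< 1$, mesh times $D$ is at most $B + x_0 + 1$: this
    many steps of length $1/D$ cross any cell of such a partition.\<close>
  define m where "m = nat \<lceil>B + x0 + 1\<rceil>"
  define L where "L = K1 ^ m"
  have "1 \<le> L" unfolding L_def K1_def by simp
  \<comment> \<open>If $|t| \le x_0 + 1$, then a point $s$ at distance less than $1$ from $t$ has
    $|s| \le x_0 + 2$; if $|t| > x_0 + 1$, then $s$ lies in the same tail as $t$.\<close>
  have "bounded ((\<lambda>t. \<phi> (p t)) ` {-(x0 + 2)..x0 + 2})"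
    by (intro compact_imp_bounded compact_continuous_image continuous_on_subset[OF \<phi>p]) auto
  then obtain A where A: "\<And>t. \<bar>t\<bar> \<le> x0 + 2 \<Longrightarrow> \<bar>\<phi> (p t)\<bar> \<le> A"
    unfolding bounded_iff by (force simp: abs_le_iff)
  have "0 \<le> A" using A[of 0] \<open>0 < x0\<close> by auto
  define w where "w t = A * indicator {-(x0 + 1)..x0 + 1} t
    + (L * (p t * \<bar>ln (p t)\<bar>) + L * (ln L + c) * p t)" for t
  have w_tail: "0 \<le> L * (p t * \<bar>ln (p t)\<bar>) + L * (ln L + c) * p t" for t
    using \<open>1 \<le> L\<close> \<open>0 \<le> c\<close> nn by (intro add_nonneg_nonneg mult_nonneg_nonneg) auto
  have w_nn: "0 \<le> w t" for t
    using w_tail[of t] \<open>0 \<le> A\<close> unfolding w_def by (auto simp: indicator_def)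
  have "integrable lborel (\<lambda>t. p t * \<bar>ln (p t)\<bar>)"
  proof -
    have "(\<lambda>t. indicator (supp p) t *\<^sub>R (p t * \<bar>ln (p t)\<bar>)) = (\<lambda>t. p t * \<bar>ln (p t)\<bar>)"
      by (auto simp: supp_def indicator_def)
    then show ?thesis using ent unfolding set_integrable_def by simp
  qed
  moreover have "integrable lborel (\<lambda>t. A * indicator {-(x0 + 1)..x0 + 1} t)"
    by (intro integrable_mult_right integrable_real_indicator emeasure_bounded_finite) auto
  ultimately have w_int: "integrable lborel w"
    unfolding w_def using prob_density_integrable[OF dens]
    by (intro Bochner_Integration.integrable_add) auto
  have dom: "\<bar>S N t\<bar> \<le> w t" if small: "\<delta> N < 1" for N t
  proof (cases "t \<in> {x N 0<..x N (n N)}")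
    case False
    then have "S N t = 0" unfolding S_def by (rule cell_step_outside[OF part])
    then show ?thesis using w_nn by simp
  next
    case True
    from near[OF True] obtain s where
      s: "s \<in> {x N 0..x N (n N)}" "\<bar>s - t\<bar> \<le> \<delta> N" "S N t = \<phi> (p s)" by blast
    show ?thesis
    proof (cases "\<bar>t\<bar> \<le> x0 + 1")
      case True
      then have "\<bar>S N t\<bar> \<le> A" unfolding s(3) using s(2) small by (intro A) linarith
      moreover have "w t \<ge> A" using True w_tail[of t] unfolding w_def by (auto simp: indicator_def)
      ultimately show ?thesis by simp
    next
      case False
      \<comment> \<open>The strict inequalities $x_0 < D$ and $|z| < D$ are needed for all points $z$ of the
        partition range, hence the summand $x_0 + 1$.\<close>
      define D where "D = radius (x N) (n N) + x0 + 1"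
      have rad: "\<bar>z\<bar> \<le> radius (x N) (n N)" if "z \<in> {x N 0..x N (n N)}" for z
        using that unfolding radius_def by auto
      have "0 \<le> radius (x N) (n N)" unfolding radius_def by auto
      then have "D > x0" "D > 0" unfolding D_def using \<open>0 < x0\<close> by auto
      have seg: "\<bar>z\<bar> \<in> {x0<..<D}" if "z \<in> closed_segment s t" for z
      proof -
        have "z \<in> {x N 0..x N (n N)}" "\<bar>z - t\<bar> \<le> \<delta> N"
          using that s(1,2) True by (auto simp: closed_segment_eq_real_ivl split: if_splits)
        then show ?thesis
          using rad[of z] False small \<open>0 < x0\<close> unfolding D_def by auto
      qed
      have dist: "\<bar>s - t\<bar> \<le> real m / D"
      proof -
        have "\<delta> N * D = \<delta> N * radius (x N) (n N) + \<delta> N * (x0 + 1)"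
          unfolding D_def by (simp add: algebra_simps)
        also have "\<dots> \<le> B + 1 * (x0 + 1)"
          using B[of N] small \<open>0 < x0\<close> by (intro add_mono mult_right_mono) auto
        also have "\<dots> \<le> real m"
          unfolding m_def using real_nat_ceiling_ge[of "B + x0 + 1"] by simp
        finally have "\<delta> N \<le> real m / D" using \<open>D > 0\<close> by (simp add: field_simps)
        then show ?thesis using s(2) by simp
      qed
      have K1: "0 < K1" unfolding K1_def by simp
      have "p s \<le> L * p t" unfolding L_def
        by (rule chain_comparison[OF regK1[OF \<open>D > x0\<close>] K1]) (use seg dist in auto)
      moreover have "p t \<le> L * p s" unfolding L_def
        by (rule chain_comparison[OF regK1[OF \<open>D > x0\<close>] K1])
          (use seg dist in \<open>auto simp: closed_segment_commute abs_minus_commute\<close>)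
      ultimately have "p s * (\<bar>ln (p s)\<bar> + c) \<le> L * (p t * \<bar>ln (p t)\<bar>) + L * (ln L + c) * p t"
        using nn \<open>1 \<le> L\<close> \<open>0 \<le> c\<close> by (intro entropy_term_comparison)
      moreover have "\<dots> \<le> w t" using \<open>0 \<le> A\<close> unfolding w_def by simp
      ultimately show ?thesis using \<phi>_bound[OF nn, of s] unfolding s(3) by linarith
    qed
  qed
  have lim: "(\<lambda>N. S N t) \<longlonglongrightarrow> \<phi> (p t)" for t
  proof (rule LIMSEQ_I)
    fix e :: real assume "0 < e"
    have "isCont (\<lambda>t. \<phi> (p t)) t"
      using \<phi>p by (simp add: continuous_on_eq_continuous_at)
    then obtain d where "0 < d" and d: "\<And>s. \<bar>s - t\<bar> < d \<Longrightarrow> \<bar>\<phi> (p s) - \<phi> (p t)\<bar> < e"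
      using \<open>0 < e\<close> unfolding continuous_at_eps_delta dist_real_def by metis
    have "\<forall>\<^sub>F N in sequentially. \<delta> N < d" by (rule order_tendstoD(2)[OF \<delta>0 \<open>0 < d\<close>])
    moreover have "\<forall>\<^sub>F N in sequentially. x N 0 < t"
      using lower by (simp add: filterlim_at_bot_dense)
    moreover have "\<forall>\<^sub>F N in sequentially. t \<le> x N (n N)"
      using upper by (simp add: filterlim_at_top)
    ultimately have "\<forall>\<^sub>F N in sequentially. norm (S N t - \<phi> (p t)) < e"
    proof eventually_elim
      case (elim N)
      from near[of t N] elim obtain s where "\<bar>s - t\<bar> \<le> \<delta> N" "S N t = \<phi> (p s)" by auto
      then show ?case using d[of s] elim by simp
    qed
    then show "\<exists>N0. \<forall>N\<ge>N0. norm (S N t - \<phi> (p t)) < e"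
      by (simp add: eventually_sequentially)
  qed
  obtain N0 where N0: "\<And>N. N \<ge> N0 \<Longrightarrow> \<delta> N < 1"
    using order_tendstoD(2)[OF \<delta>0, of 1] by (auto simp: eventually_sequentially)
  have "(\<lambda>N. LBINT t. S (N + N0) t) \<longlonglongrightarrow> (LBINT t. \<phi> (p t))"
  proof (rule integral_dominated_convergence[where w = w])
    show "(\<lambda>t. \<phi> (p t)) \<in> borel_measurable lborel"
      using borel_measurable_continuous_onI[OF \<phi>p] by simp
    show "S (N + N0) \<in> borel_measurable lborel" for N
      unfolding S_def using cell_step_measurable by simp
    show "AE t in lborel. (\<lambda>N. S (N + N0) t) \<longlonglongrightarrow> \<phi> (p t)"
      using lim LIMSEQ_ignore_initial_segment by blast
    show "AE t in lborel. norm (S (N + N0) t) \<le> w t" for N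
      using dom[OF N0[of "N + N0"]] by simp
  qed (rule w_int)
  then have "(\<lambda>N. LBINT t. S N t) \<longlonglongrightarrow> (LBINT t. \<phi> (p t))"
    by (rule LIMSEQ_offset)
  then show ?thesis unfolding S_def integral_cell_step[OF part] .
qed

section \<open>The two entropy functions\<close>

lemma continuous_on_mult_ln: "continuous_on {0..} (\<lambda>q::real. q * ln q)"
proof (subst continuous_on_eq_continuous_within, intro ballI)
  fix q :: real assume q: "q \<in> {0..}"
  show "continuous (at q within {0..}) (\<lambda>q. q * ln q)"
  proof (cases "q = 0")
    case True
    have "((\<lambda>q::real. q * ln q) \<longlongrightarrow> 0) (at_right 0)" by real_asymp
    then show ?thesis
      using True by (simp add: continuous_within at_within_Ici_at_right)
  qed (use q in \<open>auto intro!: continuous_intros\<close>)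
qed

text \<open>In this form continuity at $0$ follows from that of $q \log q$.\<close>

lemma mult_ln_inverse_add_one:
  assumes "0 \<le> (q::real)"
  shows "q * ln (inverse q + 1) = q * ln (1 + q) - q * ln q"
proof (cases "q = 0")
  case False
  then have "inverse q + 1 = (1 + q) / q" by (simp add: field_simps)
  then show ?thesis using False assms by (simp add: ln_div algebra_simps)
qed simp

text \<open>The argument $q^{-1} + 1$ of the logarithm is at most $2 \max(q^{-1}, 1)$.\<close>

lemma mult_ln_inverse_add_one_bound:
  assumes "0 \<le> (q::real)"
  shows "\<bar>q * ln (inverse q + 1)\<bar> \<le> q * (\<bar>ln q\<bar> + ln 2)"
proof (cases "q = 0")
  case False
  then have "0 < q" using assms by simp
  have "ln (inverse q + 1) \<le> \<bar>ln q\<bar> + ln 2"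
  proof (cases "q \<le> 1")
    case True
    have "ln (inverse q + 1) \<le> ln (2 * inverse q)"
      using True \<open>0 < q\<close> by (simp add: field_simps)
    also have "\<dots> = ln 2 - ln q" using \<open>0 < q\<close> by (simp add: ln_mult ln_inverse)
    finally show ?thesis by simp
  next
    case False
    then have "ln (inverse q + 1) \<le> ln 2" by (simp add: field_simps)
    then show ?thesis by simp
  qed
  moreover have "0 \<le> ln (inverse q + 1)" using \<open>0 < q\<close> by simp
  ultimately show ?thesis using \<open>0 < q\<close> by (simp add: abs_mult)
qed simp

lemma set_integral_supp:
  assumes "\<And>t. p t = 0 \<Longrightarrow> g t = (0::real)"
  shows "(LBINT t:supp p. g t) = (LBINT t. g t)"
  unfolding set_lebesgue_integral_def
  by (intro Bochner_Integration.integral_cong) (auto simp: supp_def indicator_def assms)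

theorem theorem2:
  fixes p :: "real \<Rightarrow> real"
    and x :: "nat \<Rightarrow> nat \<Rightarrow> real"
    and k :: "nat \<Rightarrow> nat"
  assumes "prob_density p"
    and "continuous_on UNIV p"
    and "set_integrable lborel (supp p) (\<lambda>t. p t * \<bar>ln (p t)\<bar>)"
    and "tail_regular p"
    and "\<And>N. uniform_partition (x N) (k N)"
    and "filterlim (\<lambda>N. x N 0) at_bot sequentially"
    and "filterlim (\<lambda>N. x N (k N)) at_top sequentially"
    and "(\<lambda>N. mesh (x N) (k N)) \<longlonglongrightarrow> 0"
    and "Bseq (\<lambda>N. mesh (x N) (k N) * radius (x N) (k N))"
  shows "(\<lambda>N. shannon2_sum p (x N) (k N)) \<longlonglongrightarrow> shannon2 p \<and>
         (\<lambda>N. shannon3_sum p (x N) (k N)) \<longlonglongrightarrow> shannon3 p"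
proof
  have pos: "incr (x N) j \<noteq> 0" if "j \<in> {1..k N}" for N j
    using assms(5)[of N] that unfolding uniform_partition_def by fastforce
  show "(\<lambda>N. shannon2_sum p (x N) (k N)) \<longlonglongrightarrow> shannon2 p"
  proof -
    define \<phi> :: "real \<Rightarrow> real" where "\<phi> q = q * max (- ln q) 0" for q
    have \<phi>_alt: "\<phi> q = max (- (q * ln q)) 0" if "0 \<le> q" for q
      using that by (simp add: \<phi>_def max_mult_distrib_left)
    have "continuous_on {0..} (\<lambda>q::real. max (- (q * ln q)) 0)"
      by (intro continuous_intros continuous_on_mult_ln)
    then have "continuous_on {0..} \<phi>"
      by (rule continuous_on_eq) (simp add: \<phi>_alt)
    moreover have "\<bar>\<phi> q\<bar> \<le> q * (\<bar>ln q\<bar> + 0)" if "0 \<le> q" for q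
      using that unfolding \<phi>_def by (auto simp: abs_mult intro!: mult_left_mono)
    ultimately have "(\<lambda>N. \<Sum>j=1..k N. incr (x N) j * \<phi> (distr_incr p (x N) j / incr (x N) j))
        \<longlonglongrightarrow> (LBINT t. \<phi> (p t))"
      by (rule entropy_sum_tendsto[OF assms, where c = 0]) auto
    moreover have "shannon2_sum p (x N) (k N)
        = (\<Sum>j=1..k N. incr (x N) j * \<phi> (distr_incr p (x N) j / incr (x N) j))" for N
      unfolding shannon2_sum_def \<phi>_def using pos by (intro sum.cong) auto
    moreover have "shannon2 p = (LBINT t. \<phi> (p t))"
      unfolding shannon2_def \<phi>_def by (rule set_integral_supp) simp
    ultimately show ?thesis by simp
  qed
  show "(\<lambda>N. shannon3_sum p (x N) (k N)) \<longlonglongrightarrow> shannon3 p"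
  proof -
    define \<phi> :: "real \<Rightarrow> real" where "\<phi> q = q * ln (inverse q + 1)" for q
    have "continuous_on {0..} (\<lambda>q::real. q * ln (1 + q) - q * ln q)"
      by (intro continuous_intros continuous_on_mult_ln) auto
    then have "continuous_on {0..} \<phi>"
      by (rule continuous_on_eq) (simp add: \<phi>_def mult_ln_inverse_add_one)
    moreover have "\<bar>\<phi> q\<bar> \<le> q * (\<bar>ln q\<bar> + ln 2)" if "0 \<le> q" for q
      using mult_ln_inverse_add_one_bound[OF that] unfolding \<phi>_def .
    ultimately have "(\<lambda>N. \<Sum>j=1..k N. incr (x N) j * \<phi> (distr_incr p (x N) j / incr (x N) j))
        \<longlonglongrightarrow> (LBINT t. \<phi> (p t))"
      by (rule entropy_sum_tendsto[OF assms, where c = "ln 2"]) auto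
    moreover have "shannon3_sum p (x N) (k N)
        = (\<Sum>j=1..k N. incr (x N) j * \<phi> (distr_incr p (x N) j / incr (x N) j))" for N
      unfolding shannon3_sum_def \<phi>_def using pos by (intro sum.cong) auto
    moreover have "shannon3 p = (LBINT t. \<phi> (p t))"
      unfolding shannon3_def \<phi>_def by (rule set_integral_supp) simp
    ultimately show ?thesis by simp
  qed
qed

end
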